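(* Let $Q$ be an odd prime and let $a\neq 0,\pm1$ be an integer with $Q\nmid a^2-1$. Put $\omega=a+\sqrt{a^2-1}$, $\epsilon=\left(\frac{a^2-1}{Q}\right)$ and $\delta=\left(\frac{2(a+1)}{Q}\right)$. Then $$\omega^{\frac{Q-\epsilon}{2}}\equiv\delta \pmod Q,$$ or equivalently $$T_{\frac{Q-\epsilon}{2}}(a)\equiv\delta \pmod Q,\qquad U_{\frac{Q-\epsilon}{2}-1}(a)\equiv 0 \pmod Q,$$ and this implies $$T_{\frac{Q-\epsilon}{2}}(a)\equiv\delta \pmod{Q^2}.$$
   Context: $\left(\frac{\cdot}{Q}\right)$ is the Legendre symbol. $T_n$ and $U_n$ are the Chebyshev polynomials of the first and second kind: $T_0=1$, $T_1=x$, $T_{n+1}=2xT_n-T_{n-1}$, and $U_{-1}=0$, $U_0=1$, $U_{n+1}=2xU_n-U_{n-1}$. Since $a\ne 0,\pm1$, the integer $a^2-1$ is not a perfect square, and congruences involving $\omega$ modulo $Q$ are taken in the ring $\mathbb{Z}[\sqrt{a^2-1}]$ modulo the ideal generated by $Q$. One has $\omega^n=T_n(a)+U_{n-1}(a)\sqrt{a^2-1}$. *)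

theory Defs
  imports Complex_Main "HOL-Number_Theory.Number_Theory" "HOL-Computational_Algebra.Polynomial"
begin

fun cheb_T :: "nat \<Rightarrow> int poly" where
  "cheb_T 0 = 1"
| "cheb_T (Suc 0) = [:0, 1:]"
| "cheb_T (Suc (Suc n)) = [:0, 2:] * cheb_T (Suc n) - cheb_T n"

(* Integer index, so that U_{-1} = 0 is available; for indices below -1 the value 0 is arbitrary. *)
function cheb_U :: "int \<Rightarrow> int poly" where
  "cheb_U k = (if k < 0 then 0 else if k = 0 then 1
               else [:0, 2:] * cheb_U (k - 1) - cheb_U (k - 2))"
  by pat_completeness auto
termination by (relation "measure (\<lambda>k. nat (k + 1))") auto

declare cheb_U.simps [simp del]

lemma cheb_U_minus_1: "cheb_U (-1) = 0"
  and cheb_U_0: "cheb_U 0 = 1"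
  by (simp_all add: cheb_U.simps)

lemma cheb_U_rec: "k \<ge> 0 \<Longrightarrow> cheb_U (k + 1) = [:0, 2:] * cheb_U k - cheb_U (k - 1)"
  by (subst cheb_U.simps) (simp add: algebra_simps)

(* The ring Z[sqrt d] inside the reals, for d >= 0. *)
definition zsqrt :: "int \<Rightarrow> real set" where
  "zsqrt d = {of_int x + of_int y * sqrt (of_int d) | x y. True}"

(* Congruence in Z[sqrt d] modulo the ideal m Z[sqrt d]; false unless both sides lie in the ring. *)
definition zsqrt_cong :: "int \<Rightarrow> int \<Rightarrow> real \<Rightarrow> real \<Rightarrow> bool" where
  "zsqrt_cong d m \<alpha> \<beta> \<longleftrightarrow>
     \<alpha> \<in> zsqrt d \<and> \<beta> \<in> zsqrt d \<and> (\<exists>\<gamma>\<in>zsqrt d. \<alpha> - \<beta> = of_int m * \<gamma>)"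

end

theory Submission
  imports Defs
begin

text \<open>
  Put \<open>d = a\<^sup>2 - 1\<close>, \<open>b = a + 1\<close> and \<open>\<eta> = b + \<surd>d\<close>. Then \<open>\<eta>\<^sup>2 = 2b\<omega>\<close>, and \<open>\<eta>\<close> has norm
  \<open>b\<^sup>2 - d = 2b\<close>. By Frobenius and Euler's criterion \<open>\<eta>^Q\<close> is congruent to \<open>b + \<epsilon>\<surd>d\<close>, which is
  \<open>\<eta>\<close> or its conjugate. Multiplying by the conjugate or by \<open>\<eta>\<close>, respectively, gives in both cases
  \<open>2b (2b)^((Q-1)/2) \<omega>^n \<equiv> 2b\<close>, where the inner power is \<open>\<equiv> \<delta>\<close> by Euler's criterion again.
  The congruence modulo \<open>Q\<^sup>2\<close> follows from the Pell equation for the Chebyshev values: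
  \<open>Q\<^sup>2\<close> divides \<open>(T - \<delta>)(T + \<delta>)\<close>, and \<open>Q\<close> does not divide the second factor.
\<close>

section \<open>Closure properties of Z[sqrt d]\<close>

lemma zsqrtI: "of_int x + of_int y * sqrt (of_int d) \<in> zsqrt d"
  by (auto simp: zsqrt_def)

lemma zsqrt_of_int [simp]: "of_int x \<in> zsqrt d"
  using zsqrtI[of x 0 d] by simp

lemma zsqrt_of_nat [simp]: "of_nat x \<in> zsqrt d"
  using zsqrt_of_int[of "int x" d] by simp

lemma zsqrt_sqrt [simp]: "sqrt (of_int d) \<in> zsqrt d"
  using zsqrtI[of 0 1 d] by simp

lemma zsqrt_add [simp]:
  assumes "\<alpha> \<in> zsqrt d" "\<beta> \<in> zsqrt d" shows "\<alpha> + \<beta> \<in> zsqrt d"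
proof -
  from assms obtain x y x' y' where "\<alpha> = of_int x + of_int y * sqrt (of_int d)"
    "\<beta> = of_int x' + of_int y' * sqrt (of_int d)" by (auto simp: zsqrt_def)
  then have "\<alpha> + \<beta> = of_int (x + x') + of_int (y + y') * sqrt (of_int d)"
    by (simp add: algebra_simps)
  then show ?thesis by (metis zsqrtI)
qed

lemma zsqrt_mult [simp]:
  assumes "d \<ge> 0" "\<alpha> \<in> zsqrt d" "\<beta> \<in> zsqrt d" shows "\<alpha> * \<beta> \<in> zsqrt d"
proof -
  from assms obtain x y x' y' where *: "\<alpha> = of_int x + of_int y * sqrt (of_int d)"
    "\<beta> = of_int x' + of_int y' * sqrt (of_int d)" by (auto simp: zsqrt_def)
  have "sqrt (of_int d) * sqrt (of_int d) = of_int d"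
    using assms(1) by simp
  then have "\<alpha> * \<beta> = of_int (x * x' + y * y' * d) + of_int (x * y' + x' * y) * sqrt (of_int d)"
    unfolding * by (simp add: distrib_left distrib_right mult_ac)
  then show ?thesis by (metis zsqrtI)
qed

lemma zsqrt_diff [simp]:
  assumes "d \<ge> 0" "\<alpha> \<in> zsqrt d" "\<beta> \<in> zsqrt d" shows "\<alpha> - \<beta> \<in> zsqrt d"
  using zsqrt_add[OF assms(2) zsqrt_mult[OF assms(1) zsqrt_of_int[of "-1"] assms(3)]] by simp

lemma zsqrt_power [simp]: "d \<ge> 0 \<Longrightarrow> \<alpha> \<in> zsqrt d \<Longrightarrow> \<alpha> ^ k \<in> zsqrt d"
  by (induction k) (use zsqrt_of_int[of 1 d] in simp_all)

lemma zsqrt_sum: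
  assumes "\<And>i. i \<in> A \<Longrightarrow> f i \<in> zsqrt d" shows "sum f A \<in> zsqrt d"
  using assms by (induction A rule: infinite_finite_induct) (use zsqrt_of_int[of 0 d] in simp_all)

section \<open>Congruences in Z[sqrt d]\<close>

lemma zsqrt_cong_trans:
  assumes "zsqrt_cong d m \<alpha> \<beta>" "zsqrt_cong d m \<beta> \<gamma>" shows "zsqrt_cong d m \<alpha> \<gamma>"
proof -
  from assms obtain x y where "x \<in> zsqrt d" "y \<in> zsqrt d"
    "\<alpha> - \<beta> = of_int m * x" "\<beta> - \<gamma> = of_int m * y" by (auto simp: zsqrt_cong_def)
  moreover from this have "\<alpha> - \<gamma> = of_int m * (x + y)" by (simp add: algebra_simps)
  ultimately show ?thesis using assms unfolding zsqrt_cong_def by (meson zsqrt_add)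
qed

lemma zsqrt_cong_sym:
  assumes "d \<ge> 0" "zsqrt_cong d m \<alpha> \<beta>" shows "zsqrt_cong d m \<beta> \<alpha>"
proof -
  from assms obtain x where "x \<in> zsqrt d" "\<alpha> - \<beta> = of_int m * x" by (auto simp: zsqrt_cong_def)
  then have "\<beta> - \<alpha> = of_int m * (of_int (-1) * x)" "of_int (-1) * x \<in> zsqrt d"
    using assms(1) by (simp, intro zsqrt_mult zsqrt_of_int)
  then show ?thesis using assms unfolding zsqrt_cong_def by meson
qed

lemma zsqrt_cong_mult_left:
  assumes "d \<ge> 0" "\<gamma> \<in> zsqrt d" "zsqrt_cong d m \<alpha> \<beta>"
  shows "zsqrt_cong d m (\<gamma> * \<alpha>) (\<gamma> * \<beta>)"
proof -
  from assms obtain x where "x \<in> zsqrt d" "\<alpha> - \<beta> = of_int m * x" by (auto simp: zsqrt_cong_def)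
  then have "\<gamma> * \<alpha> - \<gamma> * \<beta> = of_int m * (\<gamma> * x)" "\<gamma> * x \<in> zsqrt d"
    using assms(1,2) by (simp_all add: algebra_simps flip: right_diff_distrib)
  then show ?thesis using assms unfolding zsqrt_cong_def by (meson zsqrt_mult)
qed

lemma zsqrt_cong_add:
  assumes "zsqrt_cong d m \<alpha> \<beta>" "zsqrt_cong d m \<gamma> \<theta>"
  shows "zsqrt_cong d m (\<alpha> + \<gamma>) (\<beta> + \<theta>)"
proof -
  from assms obtain x y where "x \<in> zsqrt d" "y \<in> zsqrt d"
    "\<alpha> - \<beta> = of_int m * x" "\<gamma> - \<theta> = of_int m * y" by (auto simp: zsqrt_cong_def)
  moreover from this have "(\<alpha> + \<gamma>) - (\<beta> + \<theta>) = of_int m * (x + y)" by (simp add: algebra_simps)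
  ultimately show ?thesis using assms unfolding zsqrt_cong_def by (meson zsqrt_add)
qed

lemma zsqrt_cong_of_int:
  assumes "[x = y] (mod m)" shows "zsqrt_cong d m (of_int x) (of_int y)"
proof -
  from assms obtain k where "x - y = m * k" by (auto simp: cong_iff_dvd_diff)
  then have "real_of_int x - of_int y = of_int m * of_int k" by (metis of_int_diff of_int_mult)
  then show ?thesis unfolding zsqrt_cong_def using zsqrt_of_int by meson
qed

text \<open>An inverse \<open>e\<close> of \<open>c\<close> modulo \<open>m\<close> already exists
  among the integers, and multiplying by it undoes \<open>c\<close>. This serves to remove the
  factor 2b from the final congruence.\<close>

lemma zsqrt_cong_cancel_int:
  assumes "d \<ge> 0" "coprime c m" "zsqrt_cong d m (of_int c * \<alpha>) (of_int c * \<beta>)"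
    "\<alpha> \<in> zsqrt d" "\<beta> \<in> zsqrt d"
  shows "zsqrt_cong d m \<alpha> \<beta>"
proof -
  from assms(2) obtain e where e: "[c * e = 1] (mod m)"
    using cong_solve_coprime_int by blast
  have *: "zsqrt_cong d m (of_int e * (of_int c * \<gamma>)) \<gamma>" if "\<gamma> \<in> zsqrt d" for \<gamma>
    using zsqrt_cong_mult_left[OF assms(1) that zsqrt_cong_of_int[OF e]] by (simp add: mult_ac)
  show ?thesis
    using *[OF assms(4)] *[OF assms(5)] zsqrt_cong_mult_left[OF assms(1) zsqrt_of_int assms(3), of e]
      zsqrt_cong_sym[OF assms(1)] zsqrt_cong_trans by blast
qed

text \<open>For 0 < k < p the prime p divides the binomial coefficient, so only the two outer terms
  of the binomial expansion survive. The witness \<open>g\<close> collects the inner terms divided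
  by p, with integer coefficients, and therefore stays in the ring.\<close>

lemma zsqrt_cong_frobenius:
  assumes "d \<ge> 0" "prime p" "\<alpha> \<in> zsqrt d" "\<beta> \<in> zsqrt d"
  shows "zsqrt_cong d (int p) ((\<alpha> + \<beta>) ^ p) (\<alpha> ^ p + \<beta> ^ p)"
proof -
  define g where "g = (\<Sum>k\<in>{1..<p}. of_nat ((p choose k) div p) * \<alpha> ^ k * \<beta> ^ (p - k))"
  have p: "p > 0" using assms(2) by (simp add: prime_gt_0_nat)
  have "(\<alpha> + \<beta>) ^ p = (\<Sum>k\<in>{0..p}. of_nat (p choose k) * \<alpha> ^ k * \<beta> ^ (p - k))"
    by (simp add: binomial_ring atLeast0AtMost)
  also have "{0..p} = insert 0 (insert p {1..<p})" using p by auto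
  also have "(\<Sum>k\<in>\<dots>. of_nat (p choose k) * \<alpha> ^ k * \<beta> ^ (p - k)) = \<alpha> ^ p + \<beta> ^ p +
      (\<Sum>k\<in>{1..<p}. of_nat (p choose k) * \<alpha> ^ k * \<beta> ^ (p - k))" using p by simp
  also have "(\<Sum>k\<in>{1..<p}. of_nat (p choose k) * \<alpha> ^ k * \<beta> ^ (p - k)) = of_int (int p) * g"
    unfolding g_def sum_distrib_left
  proof (rule sum.cong[OF refl])
    fix k assume "k \<in> {1..<p}"
    then have "p dvd (p choose k)"
      using assms(2) by (intro dvd_choose_prime) auto
    then have "p choose k = p * ((p choose k) div p)" by simp
    then have "real (p choose k) = real p * real ((p choose k) div p)" by (metis of_nat_mult)
    then show "real (p choose k) * \<alpha> ^ k * \<beta> ^ (p - k) =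
      of_int (int p) * (real ((p choose k) div p) * \<alpha> ^ k * \<beta> ^ (p - k))" by simp
  qed
  finally have "(\<alpha> + \<beta>) ^ p - (\<alpha> ^ p + \<beta> ^ p) = of_int (int p) * g" by simp
  moreover have "g \<in> zsqrt d"
    unfolding g_def using assms by (intro zsqrt_sum zsqrt_mult) auto
  ultimately show ?thesis unfolding zsqrt_cong_def using assms by auto
qed

section \<open>Chebyshev values as coordinates of powers of omega, and the Pell equation\<close>

lemma omega_power:
  fixes s :: real
  assumes "s\<^sup>2 = of_int (a\<^sup>2 - 1)"
  shows "(of_int a + s) ^ n = of_int (poly (cheb_T n) a) + of_int (poly (cheb_U (int n - 1)) a) * s"
proof (induction n rule: cheb_T.induct)
  case 1
  then show ?case by (simp add: cheb_U_minus_1)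
next
  case 2
  then show ?case by (simp add: cheb_U_0)
next
  case (3 n)
  define w where "w = of_int a + s"
  \<comment> \<open>The element \<open>w\<close> is a root of X^2 - 2aX + 1, so its powers obey the
    recurrence shared by both kinds of Chebyshev polynomials.\<close>
  have "w * w = 2 * of_int a * w - 1"
    using assms by (simp add: w_def power2_eq_square algebra_simps)
  then have "w * w * w ^ n = (2 * of_int a * w - 1) * w ^ n" by simp
  then have w: "w ^ Suc (Suc n) = 2 * of_int a * w ^ Suc n - w ^ n" by (simp add: algebra_simps)
  \<comment> \<open>The index of U lags one behind that of T; for \<open>n = 0\<close> the
    recurrence reaches down to the value at -1.\<close>
  have "cheb_U (int (Suc (Suc n)) - 1) = [:0, 2:] * cheb_U (int (Suc n) - 1) - cheb_U (int n - 1)"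
    using cheb_U_rec[of "int n"] by (simp add: add.commute)
  then have "poly (cheb_U (int (Suc (Suc n)) - 1)) a =
      2 * a * poly (cheb_U (int (Suc n) - 1)) a - poly (cheb_U (int n - 1)) a" by simp
  moreover have "poly (cheb_T (Suc (Suc n))) a = 2 * a * poly (cheb_T (Suc n)) a - poly (cheb_T n) a"
    by simp
  ultimately show ?case
    unfolding w[unfolded w_def] 3
    by (simp only: of_int_diff of_int_mult of_int_numeral) (simp add: algebra_simps)
qed

text \<open>The left side is the norm of omega^n, and omega has norm 1. Since
  \<open>omega_power\<close> allows either square root of a^2 - 1, using it with -s gives the power
  of the conjugate.\<close>

lemma cheb_pell:
  assumes "a\<^sup>2 \<ge> 1"
  shows "(poly (cheb_T n) a)\<^sup>2 - (a\<^sup>2 - 1) * (poly (cheb_U (int n - 1)) a)\<^sup>2 = 1"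
proof -
  define s where "s = sqrt (of_int (a\<^sup>2 - 1))"
  define T where "T = poly (cheb_T n) a"
  define U where "U = poly (cheb_U (int n - 1)) a"
  have s: "s\<^sup>2 = of_int (a\<^sup>2 - 1)"
    unfolding s_def using assms by (intro real_sqrt_pow2) linarith
  have "real_of_int (T\<^sup>2 - (a\<^sup>2 - 1) * U\<^sup>2) = (of_int T + of_int U * s) * (of_int T + of_int U * (-s))"
    unfolding of_int_diff of_int_mult of_int_power s[symmetric, unfolded of_int_diff of_int_power]
    by (simp add: power2_eq_square algebra_simps)
  also have "\<dots> = ((of_int a + s) * (of_int a + (-s))) ^ n"
    unfolding T_def U_def using s by (simp only: power_mult_distrib omega_power power2_minus)
  also have "(of_int a + s) * (of_int a + (-s)) = 1"
    using s by (simp add: power2_eq_square algebra_simps)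
  finally have "T\<^sup>2 - (a\<^sup>2 - 1) * U\<^sup>2 = 1" by (simp only: power_one of_int_eq_1_iff)
  then show ?thesis unfolding T_def U_def .
qed

text \<open>A nontrivial relation would make a^2 - 1 a square k^2. Then (a - k)(a + k) = 1 forces
  both factors to be equal to 1 or both to -1, so that a is 1 or -1.\<close>

lemma int_sqrt_indep:
  fixes x y :: int
  assumes "\<bar>a\<bar> \<ge> 2" "of_int x + of_int y * sqrt (of_int (a\<^sup>2 - 1)) = 0"
  shows "x = 0 \<and> y = 0"
proof -
  have "a\<^sup>2 > 1" using power_mono[OF assms(1), of 2] by simp
  then have nn: "sqrt (of_int (a\<^sup>2 - 1)) ^ 2 = real_of_int (a\<^sup>2 - 1)" by (intro real_sqrt_pow2) linarith
  have "(real_of_int x)\<^sup>2 = (of_int y)\<^sup>2 * (sqrt (of_int (a\<^sup>2 - 1)))\<^sup>2"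
    using assms(2) unfolding power_mult_distrib[symmetric]
    by (metis eq_neg_iff_add_eq_0 power2_minus)
  then have xy: "x\<^sup>2 = y\<^sup>2 * (a\<^sup>2 - 1)"
    unfolding nn by (metis of_int_eq_iff of_int_mult of_int_power)
  have "y = 0"
  proof (rule ccontr)
    assume y: "y \<noteq> 0"
    have "y\<^sup>2 dvd x\<^sup>2" using xy by simp
    then obtain k where "x = y * k" by (auto elim: dvdE)
    then have "a\<^sup>2 - 1 = k\<^sup>2" using xy y by (simp add: power_mult_distrib)
    then have "(a - k) * (a + k) = 1" by (simp add: algebra_simps power2_eq_square)
    then have "a - k = 1 \<and> a + k = 1 \<or> a - k = -1 \<and> a + k = -1" by (simp add: zmult_eq_1_iff)
    then show False using assms(1) by auto
  qed
  then show ?thesis using xy by simp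
qed

section \<open>The congruence for omega^n modulo an odd prime\<close>

lemma odd_prime_not_dvd_2:
  fixes Q :: int
  assumes "prime Q" "odd Q"
  shows "\<not> Q dvd 2"
  using primes_dvd_imp_eq[of Q 2] assms by auto

lemma zsqrt_cong_omega:
  fixes Q a :: int
  assumes "prime Q" "odd Q" "\<bar>a\<bar> \<ge> 2" "\<not> Q dvd a\<^sup>2 - 1"
    and n: "n = nat ((Q - Legendre (a\<^sup>2 - 1) Q) div 2)"
  shows "zsqrt_cong (a\<^sup>2 - 1) Q ((of_int a + sqrt (of_int (a\<^sup>2 - 1))) ^ n)
    (of_int (Legendre (2 * (a + 1)) Q))"
proof -
  define d where "d = a\<^sup>2 - 1"
  define s where "s = sqrt (real_of_int d)"
  define \<omega> where "\<omega> = of_int a + s"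
  define b where "b = a + 1"
  define \<eta> where "\<eta> = of_int b + s"
  define p where "p = nat Q"
  define h where "h = (p - 1) div 2"
  have "2\<^sup>2 \<le> \<bar>a\<bar>\<^sup>2" using assms(3) by (rule power_mono) simp
  then have "a\<^sup>2 \<ge> 4" by simp
  then have d: "d \<ge> 0" unfolding d_def by linarith
  have s2: "s * s = of_int d" using d by (simp add: s_def)
  have Q2: "Q > 2" using assms(1,2) prime_ge_2_int[of Q] by (cases "Q = 2") auto
  then have Qp: "Q = int p" by (simp add: p_def)
  have p: "prime p" "p > 2" using assms(1) Q2 unfolding Qp by simp_all
  have ph: "p = Suc (2 * h)" using assms(2) unfolding Qp h_def by presburger
  have fact: "a\<^sup>2 - 1 = (a - 1) * b" by (simp add: b_def power2_eq_square algebra_simps)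
  have "\<not> Q dvd b" using assms(4) unfolding fact by auto
  then have nd: "\<not> Q dvd 2 * b"
    using odd_prime_not_dvd_2[OF assms(1,2)] assms(1) prime_dvd_mult_iff by blast
  have euler: "[x ^ h = Legendre x Q] (mod Q)" for x
    using euler_criterion[OF p, of x] unfolding Qp h_def by (rule cong_sym)
  \<comment> \<open>This is Fermat's little theorem, obtained by squaring Euler's criterion: the
    Legendre symbol of b is 1 or -1 because Q does not divide b.\<close>
  have b_pow: "[b ^ p = b] (mod Q)"
  proof -
    have "[(b ^ h)\<^sup>2 = (Legendre b Q)\<^sup>2] (mod Q)" using euler by (rule cong_pow)
    moreover have "(Legendre b Q)\<^sup>2 = 1"
      using \<open>\<not> Q dvd b\<close> by (simp add: Legendre_def cong_0_iff)
    ultimately have "[b * (b ^ h)\<^sup>2 = b * 1] (mod Q)" by (intro cong_scalar_left) simp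
    then show ?thesis by (simp add: ph power_mult mult.commute flip: power_mult)
  qed
  have mem: "s \<in> zsqrt d" "\<omega> \<in> zsqrt d" "\<eta> \<in> zsqrt d" "of_int b - s \<in> zsqrt d"
    using d unfolding s_def \<omega>_def \<eta>_def by (auto intro!: zsqrt_add zsqrt_diff)
  \<comment> \<open>Both identities rest on d = (a - 1) b, which makes b a common factor: b^2 + d =
    2ab and b^2 - d = 2b.\<close>
  have eta_sq: "\<eta> * \<eta> = of_int (2 * b) * \<omega>" and norm: "(of_int b - s) * \<eta> = of_int (2 * b)"
    using s2 unfolding \<eta>_def \<omega>_def b_def d_def by (simp_all add: power2_eq_square algebra_simps)
  define e where "e = Legendre d Q"
  have e: "e = 1 \<or> e = -1"
    using assms(4) by (auto simp: e_def Legendre_def cong_0_iff d_def)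
  \<comment> \<open>As p = 2h + 1, one factor s remains and the others pair up to d^h, which Euler's
    criterion turns into \<open>e\<close>. Modulo Q, the p-th power map thus fixes s or changes its
    sign.\<close>
  have "s ^ p = s * (s * s) ^ h" by (simp add: ph power_mult power2_eq_square)
  then have sp: "s ^ p = s * of_int (d ^ h)" using s2 by simp
  have frob: "zsqrt_cong d Q (\<eta> ^ p) (of_int b + s * of_int e)"
  proof (rule zsqrt_cong_trans)
    show "zsqrt_cong d Q (\<eta> ^ p) (of_int (b ^ p) + s * of_int (d ^ h))"
      using zsqrt_cong_frobenius[OF d p(1) zsqrt_of_int[of b] mem(1)]
      unfolding sp \<eta>_def Qp by simp
    show "zsqrt_cong d Q (of_int (b ^ p) + s * of_int (d ^ h)) (of_int b + s * of_int e)"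
      using b_pow euler[of d] d mem(1) unfolding e_def
      by (intro zsqrt_cong_add zsqrt_cong_mult_left zsqrt_cong_of_int)
  qed
  have key: "zsqrt_cong d Q (of_int (2 * b * (2 * b) ^ h) * \<omega> ^ n) (of_int (2 * b))"
    using e
  proof
    \<comment> \<open>Here n = h. In conj(eta) * eta^(2h+1), one eta joins the conjugate to give the
      norm 2b, and the others form h copies of eta^2 = 2b omega.\<close>
    assume e1: "e = 1"
    then have "n = h" unfolding n Qp ph e_def d_def by simp
    have "zsqrt_cong d Q ((of_int b - s) * \<eta> ^ p) ((of_int b - s) * \<eta>)"
      using zsqrt_cong_mult_left[OF d mem(4) frob] e1 by (simp add: \<eta>_def)
    moreover have "(of_int b - s) * \<eta> ^ p = ((of_int b - s) * \<eta>) * (\<eta> * \<eta>) ^ h"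
      by (simp add: ph power_mult power2_eq_square)
    ultimately show ?thesis
      unfolding norm eta_sq \<open>n = h\<close> by (simp add: power_mult_distrib mult_ac)
  next
    \<comment> \<open>Here n = h + 1. Now eta^p is congruent to the conjugate, so one more factor
      eta yields the norm on the right and the even power eta^(2h+2) on the left.\<close>
    assume e1: "e = -1"
    then have "n = Suc h" unfolding n Qp ph e_def d_def by simp
    have "zsqrt_cong d Q (\<eta> * \<eta> ^ p) ((of_int b - s) * \<eta>)"
      using zsqrt_cong_mult_left[OF d mem(3) frob] e1 by (simp add: mult.commute)
    moreover have "\<eta> * \<eta> ^ p = (\<eta> * \<eta>) ^ Suc h"
      by (simp add: ph mult.assoc power_mult_distrib mult_2 power_add)
    ultimately show ?thesis
      unfolding norm eta_sq \<open>n = Suc h\<close>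
      by (simp only: power_mult_distrib of_int_power of_int_mult power_Suc mult_ac)
  qed
  define l where "l = Legendre (2 * b) Q"
  have l: "l * l = 1" using nd by (simp add: l_def Legendre_def cong_0_iff)
  have cong: "zsqrt_cong d Q (of_int (2 * b) * \<omega> ^ n) (of_int (2 * b) * of_int l)"
  proof -
    \<comment> \<open>As \<open>l\<close> is its own inverse, multiplying \<open>key\<close> by
      \<open>l\<close> cancels the power (2b)^h on the left and leaves \<open>l\<close> on the
      right.\<close>
    have "[l * (2 * b) ^ h = 1] (mod Q)"
      using cong_scalar_left[OF euler[of "2 * b"], of l] l by (simp add: l_def)
    then have "[2 * b * 1 = 2 * b * (l * (2 * b) ^ h)] (mod Q)"
      by (rule cong_scalar_left[OF cong_sym])
    then have "[2 * b = l * (2 * b * (2 * b) ^ h)] (mod Q)"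
      by (simp only: mult_1_right mult.left_commute[of "2 * b" l])
    then have "zsqrt_cong d Q (\<omega> ^ n * of_int (2 * b)) (\<omega> ^ n * of_int (l * (2 * b * (2 * b) ^ h)))"
      using d mem by (intro zsqrt_cong_mult_left zsqrt_cong_of_int zsqrt_power)
    also have "\<omega> ^ n * of_int (l * (2 * b * (2 * b) ^ h)) = of_int l * (of_int (2 * b * (2 * b) ^ h) * \<omega> ^ n)"
      by (simp only: of_int_mult mult_ac)
    finally show ?thesis
      using zsqrt_cong_trans zsqrt_cong_mult_left[OF d zsqrt_of_int key] by (metis mult.commute)
  qed
  have "coprime (2 * b) Q" using prime_imp_coprime[OF assms(1) nd] by (subst coprime_commute)
  then have "zsqrt_cong d Q (\<omega> ^ n) (of_int l)"
    using cong zsqrt_power[OF d mem(2)] zsqrt_of_int by (rule zsqrt_cong_cancel_int[OF d])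
  then show ?thesis unfolding \<omega>_def s_def d_def l_def b_def .
qed

section \<open>Passage to the Chebyshev values and lifting to the square of Q\<close>

lemma zsqrt_cong_of_int_iff:
  assumes "\<bar>a\<bar> \<ge> 2"
  shows "zsqrt_cong (a\<^sup>2 - 1) m (of_int x + of_int y * sqrt (of_int (a\<^sup>2 - 1))) (of_int z)
    \<longleftrightarrow> [x = z] (mod m) \<and> [y = 0] (mod m)" (is "?L \<longleftrightarrow> ?R")
proof
  assume ?L
  then obtain u v where "of_int x + of_int y * sqrt (of_int (a\<^sup>2 - 1)) - of_int z =
      of_int m * (of_int u + of_int v * sqrt (real_of_int (a\<^sup>2 - 1)))"
    by (auto simp: zsqrt_cong_def zsqrt_def)
  \<comment> \<open>Collecting the coefficients of 1 and of the square root lets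
    \<open>int_sqrt_indep\<close> split the real equation into two integer ones.\<close>
  then have "of_int (x - z - m * u) + of_int (y - m * v) * sqrt (real_of_int (a\<^sup>2 - 1)) = 0"
    by (simp add: algebra_simps)
  from int_sqrt_indep[OF assms this] show ?R by (auto simp: cong_iff_dvd_diff)
next
  assume ?R
  then obtain u v where uv: "x - z = m * u" "y = m * v" by (auto simp: cong_iff_dvd_diff dvd_def)
  then have "real_of_int x - of_int z = of_int m * of_int u" by (metis of_int_diff of_int_mult)
  then have "of_int x + of_int y * sqrt (of_int (a\<^sup>2 - 1)) - of_int z =
      of_int m * (of_int u + of_int v * sqrt (real_of_int (a\<^sup>2 - 1)))"
    using uv(2) by (simp add: algebra_simps)
  then show ?L unfolding zsqrt_cong_def using zsqrtI zsqrt_of_int by meson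
qed

text \<open>If Q divided both t - \<delta> and t + \<delta>, it would divide their difference, which
  is 2 or -2 up to order. So t + \<delta> is coprime to Q^2, and all of Q^2 must divide t -
  \<delta>.\<close>

lemma cong_square_lift:
  fixes Q t \<delta> :: int
  assumes "prime Q" "odd Q" "\<delta>\<^sup>2 = 1" "[t\<^sup>2 = 1] (mod Q\<^sup>2)" "[t = \<delta>] (mod Q)"
  shows "[t = \<delta>] (mod Q\<^sup>2)"
proof -
  have \<delta>: "\<delta> = 1 \<or> \<delta> = -1" using assms(3) by (simp add: power2_eq_1_iff)
  have "\<not> Q dvd t + \<delta>"
  proof
    assume "Q dvd t + \<delta>"
    moreover have "Q dvd t - \<delta>" using assms(5) by (simp add: cong_iff_dvd_diff)
    ultimately have "Q dvd (t + \<delta>) - (t - \<delta>)" by (rule dvd_diff)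
    then have "Q dvd 2" using \<delta> by auto
    then show False using odd_prime_not_dvd_2[OF assms(1,2)] by contradiction
  qed
  then have "coprime (Q\<^sup>2) (t + \<delta>)" using assms(1) by (simp add: prime_imp_coprime)
  moreover have "t\<^sup>2 - 1 = (t - \<delta>) * (t + \<delta>)"
    using assms(3) by (simp add: power2_eq_square algebra_simps)
  then have "Q\<^sup>2 dvd (t - \<delta>) * (t + \<delta>)" using assms(4) by (simp add: cong_iff_dvd_diff)
  ultimately show ?thesis by (simp add: cong_iff_dvd_diff coprime_dvd_mult_left_iff)
qed

theorem lemma1p6:
  fixes Q a \<epsilon> \<delta> :: int and \<omega> :: real and n :: nat
  assumes "prime Q" and "odd Q"
    and "a \<noteq> 0" and "a \<noteq> 1" and "a \<noteq> -1"
    and "\<not> Q dvd a\<^sup>2 - 1"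
    and "\<omega> = of_int a + sqrt (of_int (a\<^sup>2 - 1))"
    and "\<epsilon> = Legendre (a\<^sup>2 - 1) Q"
    and "\<delta> = Legendre (2 * (a + 1)) Q"
    and "n = nat ((Q - \<epsilon>) div 2)"
  shows "zsqrt_cong (a\<^sup>2 - 1) Q (\<omega> ^ n) (of_int \<delta>)
    \<and> (zsqrt_cong (a\<^sup>2 - 1) Q (\<omega> ^ n) (of_int \<delta>)
         \<longleftrightarrow> [poly (cheb_T n) a = \<delta>] (mod Q) \<and> [poly (cheb_U (int n - 1)) a = 0] (mod Q))
    \<and> ([poly (cheb_T n) a = \<delta>] (mod Q) \<and> [poly (cheb_U (int n - 1)) a = 0] (mod Q)
         \<longrightarrow> [poly (cheb_T n) a = \<delta>] (mod Q\<^sup>2))"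
proof -
  have a2: "\<bar>a\<bar> \<ge> 2" using assms(3-5) by auto
  then have a1: "a\<^sup>2 \<ge> 1" using power_mono[of 1 "\<bar>a\<bar>" 2] by simp
  define T where "T = poly (cheb_T n) a"
  define U where "U = poly (cheb_U (int n - 1)) a"
  have "(sqrt (of_int (a\<^sup>2 - 1)))\<^sup>2 = real_of_int (a\<^sup>2 - 1)"
    using a1 by (intro real_sqrt_pow2) linarith
  then have \<omega>: "\<omega> ^ n = of_int T + of_int U * sqrt (of_int (a\<^sup>2 - 1))"
    unfolding assms(7) T_def U_def by (rule omega_power)
  have "zsqrt_cong (a\<^sup>2 - 1) Q (\<omega> ^ n) (of_int \<delta>)"
    using zsqrt_cong_omega[OF assms(1,2) a2 assms(6)] assms(7-10) by simp
  moreover have "zsqrt_cong (a\<^sup>2 - 1) Q (\<omega> ^ n) (of_int \<delta>) \<longleftrightarrow> [T = \<delta>] (mod Q) \<and> [U = 0] (mod Q)"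
    unfolding \<omega> by (rule zsqrt_cong_of_int_iff[OF a2])
  moreover have "[T = \<delta>] (mod Q\<^sup>2)" if "[T = \<delta>] (mod Q)" "[U = 0] (mod Q)"
  proof (rule cong_square_lift[OF assms(1,2) _ _ that(1)])
    have "a\<^sup>2 - 1 = (a - 1) * (a + 1)" by (simp add: power2_eq_square algebra_simps)
    then have "\<not> Q dvd a + 1" using assms(6) by auto
    then have "\<not> Q dvd 2 * (a + 1)"
      using odd_prime_not_dvd_2[OF assms(1,2)] assms(1) prime_dvd_mult_iff by blast
    then show "\<delta>\<^sup>2 = 1" unfolding assms(9) by (simp add: Legendre_def cong_0_iff)
    \<comment> \<open>The gain from Q to Q^2 comes from here: U enters the Pell equation only
      through its square.\<close>
    have "Q\<^sup>2 dvd U\<^sup>2" using that(2) by (simp add: cong_0_iff)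
    then have "Q\<^sup>2 dvd (a\<^sup>2 - 1) * U\<^sup>2" by simp
    moreover have "T\<^sup>2 - 1 = (a\<^sup>2 - 1) * U\<^sup>2" using cheb_pell[OF a1, of n] unfolding T_def U_def by simp
    ultimately show "[T\<^sup>2 = 1] (mod Q\<^sup>2)" by (simp add: cong_iff_dvd_diff)
  qed
  ultimately show ?thesis unfolding T_def U_def by blast
qed

end
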